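(* Let $n\in\mathbb{N}$. For every $\mathcal{Q}\in\mathbb{M}^n_{\mathrm{cross}}$ there are $n$ rank-1 orthogonal projection matrices $P^1,\ldots,P^n$ (real symmetric $n\times n$ matrices of trace 1) with pairwise perpendicular images such that $$\mathcal{Q}=\sum_{j=1}^n P^j\otimes P^j .$$ In other words, for every $\mathcal{Q}\in\mathbb{M}^n_{\mathrm{cross}}$ there are real symmetric $n\times n$ matrices $P^1,\ldots,P^n$ of trace 1 such that $$I=\sum_{j=1}^n P^j,\qquad (P^j)^2=(P^j)^T=P^j,\quad \operatorname{tr}(P^j)=1,\quad P^jP^k=P^kP^j=\delta_{kj}P^j$$ for all $j,k=1,\ldots,n$, and $$\mathcal{Q}=\sum_{j=1}^n P^j\otimes P^j .$$
   Context: A tensor $\mathcal{Q}=(\mathcal{Q}_{ijrs})_{1\le i,j,r,s\le n}$ with real entries is viewed as an $n\times n$ block matrix whose $(i,j)$ block is the $n\times n$ matrix $\mathcal{Q}_{ij}$ with $(r,s)$ entry $\mathcal{Q}_{ijrs}$; equivalently as an $n^2\times n^2$ real matrix. Products are products of block matrices: $(\mathcal{Q}\mathcal{R})_{ij}=\sum_{k=1}^n\mathcal{Q}_{ik}\mathcal{R}_{kj}$ (i.e. the usual product of $n^2\times n^2$ matrices). For $n\times n$ matrices $A,B$, the tensor product is $(A\otimes B)_{ijrs}=A_{ij}B_{rs}$. Define $$\mathbb{M}^n_{\mathrm{relax}}=\{\mathcal{Q}:\ \mathcal{Q}_{ijrs}\text{ is invariant under all permutations of its four indices, and } \operatorname{tr}(\mathcal{Q}_{ij})=\delta_{ij}\text{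 for all } i,j\},$$ $$\mathbb{M}^n_{\mathrm{cross}}=\{\mathcal{Q}\in\mathbb{M}^n_{\mathrm{relax}}:\ \mathcal{Q}^2=\mathcal{Q}\}.$$ *)

theory Defs
  imports "HOL-Analysis.Analysis"
begin

text \<open>
  The entry with indices \<open>i j r s\<close> of a tensor \<open>Q\<close> is \<open>Q $ i $ j $ r $ s\<close>, so that \<open>Q $ i $ j\<close> is
  the \<open>(i, j)\<close> block. Note that the library product \<open>**\<close> must not be used on tensors: at this
  type it would multiply the blocks entrywise instead of as matrices.
\<close>

type_synonym 'n tensor = "real ^ 'n ^ 'n ^ 'n ^ 'n"

definition block_mult :: "('n::finite) tensor \<Rightarrow> 'n tensor \<Rightarrow> 'n tensor" where
  "block_mult Q R = (\<chi> i j. \<Sum>k\<in>UNIV. Q $ i $ k ** R $ k $ j)"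

definition tensor_prod :: "real ^ 'n ^ 'n \<Rightarrow> real ^ 'n ^ 'n \<Rightarrow> ('n::finite) tensor" where
  "tensor_prod A B = (\<chi> i j r s. A $ i $ j * B $ r $ s)"

text \<open>The four indices are given as a function \<open>f\<close> on \<open>{1..4}\<close>, permuted by precomposition.\<close>

definition fully_symmetric :: "('n::finite) tensor \<Rightarrow> bool" where
  "fully_symmetric Q \<longleftrightarrow>
     (\<forall>p f. p permutes {1..4::nat} \<longrightarrow>
        Q $ f (p 1) $ f (p 2) $ f (p 3) $ f (p 4) = Q $ f 1 $ f 2 $ f 3 $ f 4)"

definition M_relax :: "('n::finite) tensor set" where
  "M_relax = {Q. fully_symmetric Q \<and> (\<forall>i j. trace (Q $ i $ j) = (if i = j then 1 else 0))}"

definition M_cross :: "('n::finite) tensor set" where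
  "M_cross = {Q \<in> M_relax. block_mult Q Q = Q}"

definition orthogonal_projection_matrix :: "real ^ 'n ^ 'n \<Rightarrow> bool" where
  "orthogonal_projection_matrix P \<longleftrightarrow> P ** P = P \<and> transpose P = P"

end

theory Submission
  imports Defs
begin

text \<open>
  The blocks of \<open>Q\<close> are symmetric matrices, and the symmetry, trace and idempotency conditions
  force them to commute: for a block \<open>B\<close>, the squared norms of the commutators of \<open>B\<close> with all
  blocks sum to zero. Hence the blocks share an orthonormal eigenbasis \<open>v\<close>, in which \<open>Q\<close> takes the
  value zero on \<open>(v a, v b, v c, v d)\<close> unless \<open>c = d\<close>, and so, by symmetry, unless all four
  arguments agree; the trace condition makes the remaining values \<open>1\<close>.
\<close>

section \<open>Joint eigenvectors of commuting self-adjoint operators\<close>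

definition self_adjoint :: "('a::real_inner \<Rightarrow> 'a) \<Rightarrow> bool" where
  "self_adjoint f \<longleftrightarrow> linear f \<and> (\<forall>x y. f x \<bullet> y = x \<bullet> f y)"

text \<open>An eigenvector is found as a maximiser of the Rayleigh quotient on the unit sphere of \<open>W\<close>.\<close>

lemma self_adjoint_eigenvector:
  fixes f :: "'a::euclidean_space \<Rightarrow> 'a"
  assumes f: "self_adjoint f" and W: "subspace W" "W \<noteq> {0}" and inv: "f ` W \<subseteq> W"
  shows "\<exists>v\<in>W. v \<noteq> 0 \<and> (\<exists>c. f v = c *\<^sub>R v)"
proof -
  have lin: "linear f" and adj: "\<And>x y. f x \<bullet> y = x \<bullet> f y"
    using f by (auto simp: self_adjoint_def)
  let ?S = "W \<inter> sphere 0 1"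
  obtain w where w: "w \<in> W" "w \<noteq> 0"
    using W subspace_0 by blast
  then have "w /\<^sub>R norm w \<in> ?S"
    using W by (simp add: subspace_mul)
  then have "?S \<noteq> {}" by blast
  moreover have "compact ?S"
    by (simp add: W closed_Int_compact closed_subspace)
  moreover have "continuous_on ?S (\<lambda>x. x \<bullet> f x)"
    by (intro continuous_intros linear_continuous_on linear_conv_bounded_linear[THEN iffD1] lin)
  ultimately obtain v where v: "v \<in> ?S" and max: "\<And>y. y \<in> ?S \<Longrightarrow> y \<bullet> f y \<le> v \<bullet> f v"
    using continuous_attains_sup by metis
  define c where "c = v \<bullet> f v"
  have vW: "v \<in> W" and vv: "v \<bullet> v = 1"
    using v by (auto simp: norm_eq_1)
  have bound: "y \<bullet> f y \<le> c * (y \<bullet> y)" if "y \<in> W" for y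
  proof (cases "y = 0")
    case False
    then have "y /\<^sub>R norm y \<in> ?S"
      using W that by (simp add: subspace_mul)
    from max[OF this] have "(y \<bullet> f y) / (norm y)\<^sup>2 \<le> c"
      by (simp add: c_def linear_cmul[OF lin] power2_eq_square divide_simps)
    then show ?thesis
      using False by (simp add: divide_simps dot_square_norm)
  qed (simp add: linear_0[OF lin])
  \<comment> \<open>\<open>w\<close> is the residual of the eigenvalue equation. If it were nonzero,
    moving from \<open>v\<close> towards \<open>w\<close> would raise the Rayleigh quotient to first
    order, against the maximality of \<open>c\<close>.\<close>
  define w where "w = f v - c *\<^sub>R v"
  have wW: "w \<in> W"
    unfolding w_def using W inv vW by (auto intro: subspace_diff subspace_mul)
  define b where "b = c * (w \<bullet> w) - w \<bullet> f w"
  have b: "b \<ge> 0"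
    using bound[OF wW] by (simp add: b_def)
  \<comment> \<open>Apply \<open>bound\<close> at \<open>v + t *\<^sub>R w\<close>: the zeroth-order
    terms and the terms with \<open>w \<bullet> v\<close> cancel, leaving a linear term against a
    quadratic one.\<close>
  have quad: "2 * t * (w \<bullet> w) \<le> t\<^sup>2 * b" for t
  proof -
    have "v + t *\<^sub>R w \<in> W"
      using W vW wW by (simp add: subspace_add subspace_mul)
    from bound[OF this]
    have "c + 2 * t * (w \<bullet> f v) + t\<^sup>2 * (w \<bullet> f w) \<le> c * (1 + 2 * t * (w \<bullet> v) + t\<^sup>2 * (w \<bullet> w))"
      using adj[of v w]
      by (simp add: linear_add[OF lin] linear_cmul[OF lin] inner_add_left inner_add_right vv
          c_def[symmetric] inner_commute power2_eq_square algebra_simps)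
    moreover have "w \<bullet> f v = w \<bullet> w + c * (w \<bullet> v)"
      by (subst (3) w_def) (simp add: inner_diff_right)
    ultimately show ?thesis
      by (simp only: b_def) (simp add: algebra_simps)
  qed
  have "w \<bullet> w = 0"
  proof (rule ccontr)
    assume "w \<bullet> w \<noteq> 0"
    then have pos: "w \<bullet> w > 0" by simp
    \<comment> \<open>Small enough that the linear term wins: \<open>t * b\<close> stays below
      \<open>w \<bullet> w\<close>. The \<open>+ 1\<close> covers \<open>b = 0\<close>.\<close>
    define t where "t = w \<bullet> w / (b + 1)"
    have t: "t > 0" "t * (b + 1) = w \<bullet> w"
      using pos b by (auto simp: t_def)
    have "t * (2 * (w \<bullet> w)) \<le> t * (t * b)"
      using quad[of t] by (simp add: power2_eq_square mult_ac)
    then have "2 * (w \<bullet> w) \<le> t * b"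
      using t(1) by simp
    then show False
      using t pos by (simp add: algebra_simps)
  qed
  then have "f v = c *\<^sub>R v"
    by (simp add: w_def)
  moreover have "v \<noteq> 0"
    using vv by auto
  ultimately show ?thesis
    using vW by blast
qed

text \<open>Either every operator is a multiple of the identity on \<open>W\<close>, or some eigenspace in \<open>W\<close> is a
  smaller subspace which is still invariant under the whole commuting family.\<close>

lemma commuting_joint_eigenvector:
  fixes F :: "('a::euclidean_space \<Rightarrow> 'a) set"
  assumes F: "\<And>f. f \<in> F \<Longrightarrow> self_adjoint f"
    and comm: "\<And>f g x. f \<in> F \<Longrightarrow> g \<in> F \<Longrightarrow> f (g x) = g (f x)"
    and "subspace W" "W \<noteq> {0}" "\<And>f. f \<in> F \<Longrightarrow> f ` W \<subseteq> W"
  shows "\<exists>v\<in>W. v \<noteq> 0 \<and> (\<forall>f\<in>F. \<exists>c. f v = c *\<^sub>R v)"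
  using assms(3-5)
proof (induction "dim W" arbitrary: W rule: less_induct)
  case less
  show ?case
  proof (cases "\<forall>f\<in>F. \<exists>c. \<forall>x\<in>W. f x = c *\<^sub>R x")
    case True
    then show ?thesis
      using less.prems subspace_0 by blast
  next
    case False
    then obtain f where f: "f \<in> F" "\<And>c. \<exists>x\<in>W. f x \<noteq> c *\<^sub>R x" by blast
    obtain v c where v: "v \<in> W" "v \<noteq> 0" "f v = c *\<^sub>R v"
      using self_adjoint_eigenvector[OF F[OF f(1)] less.prems(1,2)] less.prems(3)[OF f(1)] by blast
    define W' where "W' = {x \<in> W. f x = c *\<^sub>R x}"
    have lin: "linear g" if "g \<in> F" for g
      using F[OF that] by (simp add: self_adjoint_def)
    have sub: "subspace W'"
      using less.prems(1) lin[OF f(1)]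
      by (auto simp: W'_def subspace_def linear_0 linear_add linear_cmul scaleR_add_right)
    have "W' \<subset> W"
      using f(2)[of c] by (auto simp: W'_def)
    then have "dim W' < dim W"
      using sub less.prems(1) by (simp add: dim_psubset span_eq_iff[THEN iffD2])
    moreover have "W' \<noteq> {0}"
      using v by (auto simp: W'_def)
    moreover have "g ` W' \<subseteq> W'" if "g \<in> F" for g
      using less.prems(3)[OF that] comm[OF f(1) that]
      by (auto simp: W'_def linear_cmul[OF lin[OF that]])
    ultimately obtain u where "u \<in> W'" "u \<noteq> 0" "\<forall>f\<in>F. \<exists>c. f u = c *\<^sub>R u"
      using less.hyps[of W'] sub by blast
    then show ?thesis
      by (auto simp: W'_def)
  qed
qed

text \<open>By self-adjointness, the orthogonal complement of the eigenvectors found so far is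
  invariant under \<open>F\<close>. It is nonzero while fewer than \<open>DIM('a)\<close> have been
  chosen, so it contains a further joint eigenvector.\<close>

lemma commuting_orthonormal_eigenvectors:
  fixes F :: "('a::euclidean_space \<Rightarrow> 'a) set"
  assumes F: "\<And>f. f \<in> F \<Longrightarrow> self_adjoint f"
    and comm: "\<And>f g x. f \<in> F \<Longrightarrow> g \<in> F \<Longrightarrow> f (g x) = g (f x)"
    and "k \<le> DIM('a)"
  shows "\<exists>B. finite B \<and> card B = k \<and> pairwise orthogonal B \<and>
    (\<forall>b\<in>B. norm b = 1 \<and> (\<forall>f\<in>F. \<exists>c. f b = c *\<^sub>R b))"
  using assms(3)
proof (induction k)
  case 0
  show ?case by (intro exI[of _ "{}"]) simp
next
  case (Suc k)
  then obtain B where B: "finite B" "card B = k" "pairwise orthogonal B"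
    "\<And>b. b \<in> B \<Longrightarrow> norm b = 1" "\<And>b f. b \<in> B \<Longrightarrow> f \<in> F \<Longrightarrow> \<exists>c. f b = c *\<^sub>R b"
    by (auto simp: Ball_def)
  define W where "W = {x. \<forall>b\<in>B. orthogonal x b}"
  have sub: "subspace W"
    by (auto simp: W_def subspace_def orthogonal_clauses)
  have "dim B < DIM('a)"
    using dim_le_card'[OF B(1)] B(2) Suc.prems by simp
  then obtain x where "x \<noteq> 0" "\<And>y. y \<in> span B \<Longrightarrow> orthogonal x y"
    using orthogonal_to_subspace_exists by blast
  then have nz: "W \<noteq> {0}"
    by (auto simp: W_def span_base)
  have inv: "f ` W \<subseteq> W" if f: "f \<in> F" for f
  proof clarify
    fix x assume x: "x \<in> W"
    have "f x \<bullet> b = 0" if b: "b \<in> B" for b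
    proof -
      obtain c where "f b = c *\<^sub>R b" using B(5)[OF b f] by blast
      moreover have "f x \<bullet> b = x \<bullet> f b"
        using F[OF f] by (simp add: self_adjoint_def)
      ultimately show ?thesis
        using x b by (simp add: W_def orthogonal_def)
    qed
    then show "f x \<in> W" by (simp add: W_def orthogonal_def)
  qed
  obtain v where v: "v \<in> W" "v \<noteq> 0" "\<And>f. f \<in> F \<Longrightarrow> \<exists>c. f v = c *\<^sub>R v"
    using commuting_joint_eigenvector[of F W] F comm sub nz inv by blast
  define u where "u = v /\<^sub>R norm v"
  have u: "norm u = 1" "u \<in> W"
    using v sub by (auto simp: u_def subspace_mul)
  have "\<exists>c. f u = c *\<^sub>R u" if f: "f \<in> F" for f
  proof -
    have "linear f" using F[OF f] by (simp add: self_adjoint_def)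
    with v(3)[OF f] show ?thesis
      by (auto simp: u_def linear_cmul)
  qed
  moreover have "u \<notin> B"
    using u by (auto simp: W_def orthogonal_def norm_eq_1)
  moreover have "pairwise orthogonal (insert u B)"
    using B(3) u(2) by (auto simp: pairwise_insert W_def orthogonal_commute)
  ultimately show ?case
    using B u(1) by (intro exI[of _ "insert u B"]) auto
qed

lemma commuting_symmetric_matrices_eigenbasis:
  fixes F :: "(real ^ 'n ^ 'n) set"
  assumes sym: "\<And>A. A \<in> F \<Longrightarrow> transpose A = A"
    and comm: "\<And>A B. A \<in> F \<Longrightarrow> B \<in> F \<Longrightarrow> A ** B = B ** A"
  obtains v :: "'n \<Rightarrow> real ^ 'n" where
    "\<And>k l. v k \<bullet> v l = (if k = l then 1 else 0)"
    "\<And>A k. A \<in> F \<Longrightarrow> \<exists>c. A *v v k = c *\<^sub>R v k"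
proof -
  have "self_adjoint ((*v) A)" if "A \<in> F" for A
    using sym[OF that] dot_lmul_matrix[of _ A]
    by (auto simp: self_adjoint_def transpose_matrix_vector[symmetric])
  moreover have "A *v (B *v x) = B *v (A *v x)" if "A \<in> F" "B \<in> F" for A B x
    using comm[OF that] by (simp add: matrix_vector_mul_assoc)
  ultimately have "\<exists>B. finite B \<and> card B = DIM(real ^ 'n) \<and> pairwise orthogonal B \<and>
      (\<forall>b\<in>B. norm b = 1 \<and> (\<forall>f\<in>(*v) ` F. \<exists>c. f b = c *\<^sub>R b))"
    by (intro commuting_orthonormal_eigenvectors) auto
  then obtain B :: "(real ^ 'n) set" where B: "finite B" "card B = DIM(real ^ 'n)"
    "pairwise orthogonal B" "\<And>b. b \<in> B \<Longrightarrow> norm b = 1"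
    "\<And>b A. b \<in> B \<Longrightarrow> A \<in> F \<Longrightarrow> \<exists>c. A *v b = c *\<^sub>R b"
    by auto
  obtain v :: "'n \<Rightarrow> real ^ 'n" where v: "bij_betw v UNIV B"
    using finite_same_card_bij[of "UNIV :: 'n set" B] B(1,2) by auto
  show thesis
  proof
    show "v k \<bullet> v l = (if k = l then 1 else 0)" for k l
      using v B(3,4) by (auto simp: bij_betw_def pairwise_def orthogonal_def norm_eq_1 inj_eq)
    show "\<exists>c. A *v v k = c *\<^sub>R v k" if "A \<in> F" for A k
      using v B(5) that by (auto simp: bij_betw_def)
  qed
qed

section \<open>Symmetric idempotent tensors\<close>

text \<open>The adjacent transpositions generate all permutations of the indices, so every later
  rearrangement is a chain of these three rules.\<close>

lemma fully_symmetric_transpositions: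
  assumes "fully_symmetric Q"
  shows "Q $ j $ i $ r $ s = Q $ i $ j $ r $ s"
    and "Q $ i $ r $ j $ s = Q $ i $ j $ r $ s"
    and "Q $ i $ j $ s $ r = Q $ i $ j $ r $ s"
proof -
  define f where "f = (\<lambda>m::nat. if m = 1 then i else if m = 2 then j else if m = 3 then r else s)"
  have *: "Q $ f (Transposition.transpose a b 1) $ f (Transposition.transpose a b 2) $ f (Transposition.transpose a b 3) $ f (Transposition.transpose a b 4)
      = Q $ f 1 $ f 2 $ f 3 $ f 4" if "a \<in> {1..4}" "b \<in> {1..4}" for a b
    using assms permutes_swap_id[OF that] unfolding fully_symmetric_def by blast
  show "Q $ j $ i $ r $ s = Q $ i $ j $ r $ s"
    using *[of 1 2] by (simp add: f_def Transposition.transpose_def)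
  show "Q $ i $ r $ j $ s = Q $ i $ j $ r $ s"
    using *[of 2 3] by (simp add: f_def Transposition.transpose_def)
  show "Q $ i $ j $ s $ r = Q $ i $ j $ r $ s"
    using *[of 3 4] by (simp add: f_def Transposition.transpose_def)
qed

lemma fully_symmetric_swap_pairs:
  assumes "fully_symmetric Q"
  shows "Q $ r $ s $ i $ j = Q $ i $ j $ r $ s"
proof -
  note swap = fully_symmetric_transpositions[OF assms]
  have "Q $ r $ s $ i $ j = Q $ r $ i $ s $ j" by (rule swap(2))
  also have "\<dots> = Q $ i $ r $ s $ j" by (rule swap(1))
  also have "\<dots> = Q $ i $ r $ j $ s" by (rule swap(3))
  also have "\<dots> = Q $ i $ j $ r $ s" by (rule swap(2))
  finally show ?thesis .
qed

lemma sum_swap3: "(\<Sum>i\<in>I. \<Sum>j\<in>J. \<Sum>u\<in>U. f i j u) = (\<Sum>u\<in>U. \<Sum>i\<in>I. \<Sum>j\<in>J. f i j u)"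
proof -
  have "(\<Sum>i\<in>I. \<Sum>j\<in>J. \<Sum>u\<in>U. f i j u) = (\<Sum>i\<in>I. \<Sum>u\<in>U. \<Sum>j\<in>J. f i j u)"
    by (intro sum.cong refl sum.swap)
  then show ?thesis by (simp add: sum.swap[of _ U])
qed

section \<open>Traces, the squared Frobenius norm and commutators\<close>

lemma trace_transpose_mul_self:
  fixes X :: "real ^ 'n ^ 'n"
  shows "trace (transpose X ** X) = (\<Sum>j\<in>UNIV. \<Sum>i\<in>UNIV. (X $ i $ j)\<^sup>2)"
  by (simp add: trace_def matrix_matrix_mult_def transpose_def power2_eq_square)

lemma trace_transpose_mul_self_nonneg: "trace (transpose X ** (X :: real ^ 'n ^ 'n)) \<ge> 0"
  by (simp add: trace_transpose_mul_self sum_nonneg)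

lemma trace_transpose_mul_self_eq_0:
  "trace (transpose X ** (X :: real ^ 'n ^ 'n)) = 0 \<longleftrightarrow> X = 0"
  by (simp add: trace_transpose_mul_self sum_nonneg_eq_0_iff sum_nonneg vec_eq_iff) blast

lemma trace_sum: "trace (\<Sum>a\<in>S. f a :: real ^ 'n ^ 'n) = (\<Sum>a\<in>S. trace (f a))"
  unfolding trace_def by (simp add: sum.swap[of _ S])

lemma matrix_mul_sum_left: "(\<Sum>a\<in>S. f a) ** (B :: real ^ 'n ^ 'n) = (\<Sum>a\<in>S. f a ** B)"
  by (simp add: vec_eq_iff matrix_matrix_mult_def sum_distrib_right) (simp add: sum.swap[of _ S])

lemma matrix_mul_sum_right: "(B :: real ^ 'n ^ 'n) ** (\<Sum>a\<in>S. f a) = (\<Sum>a\<in>S. B ** f a)"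
  by (simp add: vec_eq_iff matrix_matrix_mult_def sum_distrib_left) (simp add: sum.swap[of _ S])

lemma matrix_mul_diff_left: "(A - B) ** (C :: real ^ 'n ^ 'n) = A ** C - B ** C"
  by (simp add: vec_eq_iff matrix_matrix_mult_def left_diff_distrib sum_subtractf)

lemma matrix_mul_diff_right: "(A :: real ^ 'n ^ 'n) ** (B - C) = A ** B - A ** C"
  by (simp add: vec_eq_iff matrix_matrix_mult_def right_diff_distrib sum_subtractf)

text \<open>The commutator is skew, and cyclicity of the trace merges the four products into two
  pairs. The factors \<open>B\<close> are kept outside, so that a sum over \<open>A\<close> can be
  moved inside onto \<open>A ** A\<close> and \<open>A ** B ** A\<close>.\<close>

lemma commutator_trace:
  fixes A B :: "real ^ 'n ^ 'n"
  assumes "transpose A = A" "transpose B = B"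
  shows "trace (transpose (A ** B - B ** A) ** (A ** B - B ** A))
    = 2 * trace (B ** (A ** A) ** B) - 2 * trace (B ** (A ** B ** A))"
proof -
  have "transpose (A ** B - B ** A) = B ** A - A ** B"
    using assms by (simp add: transpose_def vec_eq_iff matrix_matrix_mult_def mult.commute)
  then have "trace (transpose (A ** B - B ** A) ** (A ** B - B ** A))
      = trace (B ** A ** (A ** B)) - trace (B ** A ** (B ** A))
        - trace (A ** B ** (A ** B)) + trace (A ** B ** (B ** A))"
    by (simp add: matrix_mul_diff_left matrix_mul_diff_right trace_sub)
  moreover have "trace (A ** B ** (A ** B)) = trace (B ** (A ** B ** A))"
    by (metis matrix_mul_assoc trace_mul_sym)
  moreover have "trace (A ** B ** (B ** A)) = trace (B ** (A ** A) ** B)"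
    by (metis matrix_mul_assoc trace_mul_sym)
  ultimately show ?thesis
    by (simp add: matrix_mul_assoc)
qed

text \<open>If \<open>A\<close> runs over the blocks, then \<open>\<Sum> A\<^sup>2 = I\<close> and \<open>\<Sum> A B A = B\<close> for every block \<open>B\<close>,
  so the squared norms of the commutators \<open>[A, B]\<close> sum to \<open>2 tr (B\<^sup>2) - 2 tr (B\<^sup>2) = 0\<close>.\<close>

lemma M_cross_blocks_commute:
  fixes Q :: "('n::finite) tensor"
  assumes "Q \<in> M_cross"
  shows "Q $ i $ j ** Q $ p $ q = Q $ p $ q ** Q $ i $ j"
proof -
  have sym: "fully_symmetric Q" and tr: "\<And>i j. trace (Q $ i $ j) = (if i = j then 1 else 0)"
    and idem: "block_mult Q Q = Q"
    using assms by (auto simp: M_cross_def M_relax_def)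
  note swap = fully_symmetric_transpositions[OF sym] fully_symmetric_swap_pairs[OF sym]
  \<comment> \<open>Idempotency, with the summation indices moved by symmetry into the block
    position: sums over all blocks can now be evaluated.\<close>
  have contract: "(\<Sum>k\<in>UNIV. \<Sum>t\<in>UNIV. Q $ k $ t $ i $ r * Q $ k $ t $ j $ s) = Q $ i $ j $ r $ s"
    for i j r s
  proof -
    have "Q $ i $ j $ r $ s = (\<Sum>k\<in>UNIV. \<Sum>t\<in>UNIV. Q $ i $ k $ r $ t * Q $ k $ j $ t $ s)"
      using arg_cong[OF idem, of "\<lambda>R. R $ i $ j $ r $ s"]
      by (simp add: block_mult_def matrix_matrix_mult_def)
    moreover have "Q $ i $ k $ r $ t = Q $ k $ t $ i $ r" for k t
      using swap(1)[of i k r t] swap(2)[of k i r t] swap(3)[of k r i t]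
        swap(2)[of k r t i] swap(3)[of k t r i] by metis
    moreover have "Q $ k $ j $ t $ s = Q $ k $ t $ j $ s" for k t
      by (rule swap(2))
    ultimately show ?thesis by simp
  qed
  define B where "B = Q $ p $ q"
  have tB: "transpose (Q $ i $ j) = Q $ i $ j" for i j
    by (simp add: transpose_def vec_eq_iff swap(3))
  \<comment> \<open>By \<open>contract\<close>, entry \<open>(r, s)\<close> becomes the trace of the
    block \<open>Q $ r $ s\<close>.\<close>
  have squares: "(\<Sum>i\<in>UNIV. \<Sum>j\<in>UNIV. Q $ i $ j ** Q $ i $ j) = mat 1"
  proof -
    have "(\<Sum>i\<in>UNIV. \<Sum>j\<in>UNIV. \<Sum>u\<in>UNIV. Q $ i $ j $ r $ u * Q $ i $ j $ u $ s)
        = (if r = s then 1 else 0)" for r s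
    proof -
      have "(\<Sum>i\<in>UNIV. \<Sum>j\<in>UNIV. \<Sum>u\<in>UNIV. Q $ i $ j $ r $ u * Q $ i $ j $ u $ s)
          = (\<Sum>u\<in>UNIV. \<Sum>i\<in>UNIV. \<Sum>j\<in>UNIV. Q $ i $ j $ r $ u * Q $ i $ j $ u $ s)"
        by (rule sum_swap3)
      also have "\<dots> = (\<Sum>u\<in>UNIV. Q $ r $ s $ u $ u)"
      proof -
        have "Q $ r $ u $ u $ s = Q $ r $ s $ u $ u" for u
          using swap(3)[of r u u s] swap(2)[of r u s u] by simp
        then show ?thesis by (simp add: contract)
      qed
      finally show ?thesis
        using tr[of r s] by (simp add: trace_def)
    qed
    then show ?thesis
      by (simp add: vec_eq_iff matrix_matrix_mult_def mat_def)
  qed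
  \<comment> \<open>\<open>contract\<close> is used twice: first for the two outer factors, then,
    since \<open>B\<close> is itself a block, for the remaining sum against the entries of
    \<open>B\<close>.\<close>
  have conj: "(\<Sum>i\<in>UNIV. \<Sum>j\<in>UNIV. Q $ i $ j ** B ** Q $ i $ j) = B"
  proof -
    have "(\<Sum>i\<in>UNIV. \<Sum>j\<in>UNIV. \<Sum>w\<in>UNIV. (\<Sum>u\<in>UNIV. Q $ i $ j $ r $ u * B $ u $ w) * Q $ i $ j $ w $ s)
        = B $ r $ s" for r s
    proof -
      have "(\<Sum>i\<in>UNIV. \<Sum>j\<in>UNIV. \<Sum>w\<in>UNIV. (\<Sum>u\<in>UNIV. Q $ i $ j $ r $ u * B $ u $ w) * Q $ i $ j $ w $ s)
          = (\<Sum>w\<in>UNIV. \<Sum>i\<in>UNIV. \<Sum>j\<in>UNIV. \<Sum>u\<in>UNIV. Q $ i $ j $ r $ u * B $ u $ w * Q $ i $ j $ w $ s)"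
        by (subst sum_swap3) (simp add: sum_distrib_right)
      also have "\<dots> = (\<Sum>w\<in>UNIV. \<Sum>u\<in>UNIV. \<Sum>i\<in>UNIV. \<Sum>j\<in>UNIV. Q $ i $ j $ r $ u * B $ u $ w * Q $ i $ j $ w $ s)"
        by (intro sum.cong refl sum_swap3)
      also have "\<dots> = (\<Sum>w\<in>UNIV. \<Sum>u\<in>UNIV. B $ u $ w * (\<Sum>i\<in>UNIV. \<Sum>j\<in>UNIV. Q $ i $ j $ r $ u * Q $ i $ j $ w $ s))"
        by (simp add: sum_distrib_left mult_ac)
      also have "\<dots> = (\<Sum>w\<in>UNIV. \<Sum>u\<in>UNIV. B $ u $ w * Q $ r $ w $ u $ s)"
        by (simp only: contract)
      also have "\<dots> = (\<Sum>w\<in>UNIV. \<Sum>u\<in>UNIV. Q $ w $ u $ p $ q * Q $ w $ u $ r $ s)"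
      proof -
        have "Q $ p $ q $ u $ w = Q $ w $ u $ p $ q" "Q $ r $ w $ u $ s = Q $ w $ u $ r $ s" for u w
          using swap(3)[of p q u w] swap(4)[of w u p q] swap(1)[of r w u s] swap(2)[of w u r s]
          by simp_all
        then show ?thesis by (simp add: B_def)
      qed
      also have "\<dots> = B $ r $ s"
        unfolding contract B_def by (rule swap(2))
      finally show ?thesis .
    qed
    then show ?thesis
      by (simp add: vec_eq_iff matrix_matrix_mult_def)
  qed
  define N where "N i j = trace (transpose (Q $ i $ j ** B - B ** Q $ i $ j) ** (Q $ i $ j ** B - B ** Q $ i $ j))"
    for i j
  have "(\<Sum>i\<in>UNIV. \<Sum>j\<in>UNIV. N i j)
      = (\<Sum>i\<in>UNIV. \<Sum>j\<in>UNIV. 2 * trace (B ** (Q $ i $ j ** Q $ i $ j) ** B) - 2 * trace (B ** (Q $ i $ j ** B ** Q $ i $ j)))"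
    unfolding N_def B_def by (simp add: commutator_trace tB)
  also have "\<dots> = 2 * trace (B ** (\<Sum>i\<in>UNIV. \<Sum>j\<in>UNIV. Q $ i $ j ** Q $ i $ j) ** B)
      - 2 * trace (B ** (\<Sum>i\<in>UNIV. \<Sum>j\<in>UNIV. Q $ i $ j ** B ** Q $ i $ j))"
    by (simp only: matrix_mul_sum_left matrix_mul_sum_right trace_sum sum_subtractf sum_distrib_left)
  also have "\<dots> = 0"
    by (simp add: squares conj)
  finally have "(\<Sum>i\<in>UNIV. \<Sum>j\<in>UNIV. N i j) = 0" .
  moreover have "N i j \<ge> 0" for i j
    by (simp add: N_def trace_transpose_mul_self_nonneg)
  ultimately have "N i j = 0"
    by (simp add: sum_nonneg_eq_0_iff sum_nonneg)
  then show ?thesis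
    by (simp add: N_def trace_transpose_mul_self_eq_0 B_def)
qed

section \<open>Rank-1 matrices \<open>v v^T\<close>, which are orthogonal projections for unit
  \<open>v\<close>\<close>

definition outer_square :: "real ^ 'n \<Rightarrow> real ^ 'n ^ 'n" where
  "outer_square v = (\<chi> i j. v $ i * v $ j)"

lemma outer_square_mult_vec: "outer_square v *v x = (v \<bullet> x) *\<^sub>R v"
  by (simp add: outer_square_def vec_eq_iff matrix_vector_mult_def inner_vec_def
      sum_distrib_left mult_ac)

lemma matrix_mult_outer_square:
  "(A ** outer_square v) $ i $ j = (A *v v) $ i * v $ j"
  by (simp add: outer_square_def matrix_matrix_mult_def matrix_vector_mult_def sum_distrib_left mult_ac)

lemma trace_outer_square: "trace (outer_square v) = v \<bullet> v"
  by (simp add: outer_square_def trace_def inner_vec_def)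

lemma transpose_outer_square: "transpose (outer_square v) = outer_square v"
  by (simp add: outer_square_def transpose_def vec_eq_iff)

lemma rank_outer_square:
  assumes "v \<noteq> 0"
  shows "rank (outer_square v) = 1"
proof -
  have "range ((*v) (outer_square v)) = span {v}"
  proof (intro equalityI subsetI)
    fix x assume "x \<in> span {v}"
    then obtain c where "x = c *\<^sub>R v" by (auto simp: span_singleton)
    \<comment> \<open>Dividing by \<open>v \<bullet> v\<close> allows for a \<open>v\<close> that is
      not a unit vector.\<close>
    then have "x = outer_square v *v ((c / (v \<bullet> v)) *\<^sub>R v)"
      using assms by (simp add: outer_square_mult_vec)
    then show "x \<in> range ((*v) (outer_square v))" by blast
  qed (auto simp: outer_square_mult_vec span_singleton)
  then show ?thesis
    using assms by (simp add: rank_dim_range dim_span)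
qed

lemma outer_square_mult:
  "outer_square v ** outer_square w = (v \<bullet> w) *\<^sub>R (\<chi> i j. v $ i * w $ j)"
  by (simp add: vec_eq_iff matrix_mult_outer_square outer_square_mult_vec)

text \<open>Orthonormality says that the square matrix with rows \<open>v k\<close> has its
  transpose as right inverse. The transpose is then also a left inverse, which is the claim
  entrywise.\<close>

lemma sum_outer_square_orthonormal:
  fixes v :: "'n \<Rightarrow> real ^ 'n"
  assumes "\<And>k l. v k \<bullet> v l = (if k = l then 1 else 0)"
  shows "(\<Sum>k\<in>UNIV. outer_square (v k)) = mat 1"
proof -
  define M where "M = (\<chi> k i. v k $ i)"
  have "M ** transpose M = mat 1"
    using assms by (simp add: M_def vec_eq_iff matrix_matrix_mult_def transpose_def mat_def inner_vec_def)
  then have "transpose M ** M = mat 1"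
    by (simp add: matrix_left_right_inverse)
  then show ?thesis
    by (simp add: M_def vec_eq_iff matrix_matrix_mult_def transpose_def mat_def outer_square_def)
qed

text \<open>Spectral decomposition, by multiplying \<open>A\<close> with the resolution of the
  identity given by \<open>v\<close>.\<close>

lemma matrix_eq_sum_outer_square:
  fixes v :: "'n \<Rightarrow> real ^ 'n"
  assumes v: "\<And>k l. v k \<bullet> v l = (if k = l then 1 else 0)"
    and A: "\<And>k. A *v v k = c k *\<^sub>R v k"
  shows "A = (\<Sum>k\<in>UNIV. c k *\<^sub>R outer_square (v k))"
proof -
  have "A = A ** (\<Sum>k\<in>UNIV. outer_square (v k))"
    by (simp add: sum_outer_square_orthonormal[OF v])
  also have "\<dots> = (\<Sum>k\<in>UNIV. A ** outer_square (v k))"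
    by (rule matrix_mul_sum_right)
  also have "\<dots> = (\<Sum>k\<in>UNIV. c k *\<^sub>R outer_square (v k))"
    by (intro sum.cong refl) (simp add: vec_eq_iff matrix_mult_outer_square A, simp add: outer_square_def)
  finally show ?thesis .
qed

text \<open>For a joint eigenbasis \<open>v\<close> of the blocks, let \<open>L k\<close> be the matrix of the eigenvalues of the
  blocks on \<open>v k\<close>. By the symmetry of \<open>Q\<close>, \<open>L k\<close> kills every \<open>v l\<close> with \<open>l \<noteq> k\<close>, and it is a
  combination of blocks of trace \<open>1\<close>, so \<open>L k\<close> is the projection onto \<open>v k\<close>.\<close>

lemma M_cross_orthonormal_decomposition:
  fixes Q :: "('n::finite) tensor"
  assumes Q: "Q \<in> M_cross"
  obtains v :: "'n \<Rightarrow> real ^ 'n" where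
    "\<And>k l. v k \<bullet> v l = (if k = l then 1 else 0)"
    "Q = (\<Sum>k\<in>UNIV. tensor_prod (outer_square (v k)) (outer_square (v k)))"
proof -
  have sym: "fully_symmetric Q" and tr: "\<And>i j. trace (Q $ i $ j) = (if i = j then 1 else 0)"
    using Q by (auto simp: M_cross_def M_relax_def)
  note swap = fully_symmetric_transpositions[OF sym] fully_symmetric_swap_pairs[OF sym]
  have tB: "transpose (Q $ i $ j) = Q $ i $ j" for i j
    by (simp add: transpose_def vec_eq_iff swap(3))
  obtain v :: "'n \<Rightarrow> real ^ 'n" where v: "\<And>k l. v k \<bullet> v l = (if k = l then 1 else 0)"
    and ev: "\<And>A k. A \<in> {Q $ i $ j | i j. True} \<Longrightarrow> \<exists>c. A *v v k = c *\<^sub>R v k"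
    by (rule commuting_symmetric_matrices_eigenbasis[of "{Q $ i $ j | i j. True}"])
      (auto simp: tB M_cross_blocks_commute[OF Q])
  have "\<forall>i j k. \<exists>c. Q $ i $ j *v v k = c *\<^sub>R v k"
    using ev by blast
  then obtain c where c: "\<And>i j k. Q $ i $ j *v v k = c i j k *\<^sub>R v k"
    by metis
  define L where "L k = (\<chi> i j. c i j k)" for k
  \<comment> \<open>As \<open>v k\<close> is a unit vector, the eigenvalue is the quadratic form of
    the block at \<open>v k\<close>; thus the symmetries of \<open>Q\<close> pass to
    \<open>L k\<close>.\<close>
  have c_eq: "c i j k = (\<Sum>r\<in>UNIV. \<Sum>s\<in>UNIV. Q $ i $ j $ r $ s * v k $ s * v k $ r)" for i j k
  proof -
    have "c i j k = (Q $ i $ j *v v k) \<bullet> v k"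
      using v by (simp add: c)
    then show ?thesis
      by (simp add: inner_vec_def matrix_vector_mult_def sum_distrib_right)
  qed
  have Lsym: "L k $ i $ j = L k $ j $ i" for i j k
    by (simp add: L_def c_eq swap(1)[of j i])
  \<comment> \<open>Exchanging \<open>j\<close> and \<open>r\<close> lets the block
    \<open>Q $ i $ r\<close> act on its eigenvector \<open>v k\<close> before pairing with
    \<open>v l\<close>, which produces the factor \<open>v k \<bullet> v l\<close>.\<close>
  have Lv: "(L k *v v l) $ i = (v k \<bullet> v l) * (L k *v v k) $ i" for k l i
  proof -
    have "(L k *v v l) $ i = (\<Sum>r\<in>UNIV. \<Sum>j\<in>UNIV. \<Sum>s\<in>UNIV. Q $ i $ j $ r $ s * v k $ s * v k $ r * v l $ j)"
      by (subst sum.swap) (simp add: L_def matrix_vector_mult_def c_eq sum_distrib_right)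
    also have "\<dots> = (\<Sum>r\<in>UNIV. ((Q $ i $ r *v v k) \<bullet> v l) * v k $ r)"
      by (simp add: inner_vec_def matrix_vector_mult_def sum_distrib_right sum_distrib_left mult_ac swap(2)[of i])
    also have "\<dots> = (v k \<bullet> v l) * (L k *v v k) $ i"
      unfolding c by (simp add: L_def matrix_vector_mult_def sum_distrib_left mult_ac)
    finally show ?thesis .
  qed
  \<comment> \<open>In the expansion of \<open>L k\<close> along the basis only the term
    \<open>l = k\<close> survives, so \<open>L k\<close> has the form \<open>x y^T\<close> with
    \<open>y = v k\<close>.\<close>
  have L_entry: "L k $ i $ j = (L k *v v k) $ i * v k $ j" for i j k
  proof -
    have "L k = L k ** (\<Sum>l\<in>UNIV. outer_square (v l))"
      by (simp add: sum_outer_square_orthonormal[OF v])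
    then have "L k $ i $ j = (\<Sum>l\<in>UNIV. L k ** outer_square (v l)) $ i $ j"
      by (simp only: matrix_mul_sum_right[symmetric])
    also have "\<dots> = (\<Sum>l\<in>UNIV. (L k *v v l) $ i * v l $ j)"
      by (simp only: sum_component matrix_mult_outer_square)
    also have "\<dots> = (\<Sum>l\<in>UNIV. if k = l then (L k *v v k) $ i * v k $ j else 0)"
      by (intro sum.cong refl, subst Lv) (simp add: v)
    finally show ?thesis by simp
  qed
  \<comment> \<open>Swapping the index pairs turns the sum over \<open>i\<close> into the trace of
    \<open>Q $ r $ s\<close>, so the trace condition leaves
    \<open>v k \<bullet> v k\<close>.\<close>
  have trL: "trace (L k) = 1" for k
  proof -
    have "trace (L k) = (\<Sum>r\<in>UNIV. \<Sum>s\<in>UNIV. \<Sum>i\<in>UNIV. Q $ i $ i $ r $ s * v k $ s * v k $ r)"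
      by (subst sum_swap3) (simp add: trace_def L_def c_eq)
    also have "\<dots> = (\<Sum>r\<in>UNIV. \<Sum>s\<in>UNIV. trace (Q $ r $ s) * (v k $ s * v k $ r))"
      unfolding trace_def sum_distrib_right
      by (intro sum.cong refl) (subst swap(4), simp add: mult.assoc)
    also have "\<dots> = v k \<bullet> v k"
      by (simp add: tr inner_vec_def if_distrib[of "\<lambda>x. x * _"] cong: if_cong)
    finally show ?thesis by (simp add: v)
  qed
  \<comment> \<open>Symmetry of \<open>L k\<close> and \<open>L_entry\<close> give
    \<open>L k *v v k = trace (L k) *\<^sub>R v k\<close>.\<close>
  have Lvk: "(L k *v v k) $ i = v k $ i" for k i
  proof -
    have "(L k *v v k) $ i = (\<Sum>j\<in>UNIV. L k $ j $ i * v k $ j)"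
      by (simp add: matrix_vector_mult_def Lsym[of k i])
    also have "\<dots> = (\<Sum>j\<in>UNIV. L k $ j $ j) * v k $ i"
      by (simp add: L_entry[of k] sum_distrib_left mult_ac)
    finally show ?thesis
      using trL[of k] by (simp add: trace_def)
  qed
  have "c i j k = v k $ i * v k $ j" for i j k
    using L_entry[of k i j] by (simp add: Lvk) (simp add: L_def)
  then have "Q $ i $ j = (\<Sum>k\<in>UNIV. (v k $ i * v k $ j) *\<^sub>R outer_square (v k))" for i j
    using matrix_eq_sum_outer_square[OF v c[of i j]] by simp
  then have "Q = (\<Sum>k\<in>UNIV. tensor_prod (outer_square (v k)) (outer_square (v k)))"
    by (simp add: vec_eq_iff tensor_prod_def outer_square_def)
  with v show thesis by (rule that)
qed

theorem theorem4p2: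
  fixes Q :: "('n::finite) tensor"
  assumes "Q \<in> M_cross"
  shows "\<exists>P :: 'n \<Rightarrow> real ^ 'n ^ 'n.
     (\<forall>j. orthogonal_projection_matrix (P j) \<and> rank (P j) = 1 \<and> trace (P j) = 1) \<and>
     (\<forall>j k. j \<noteq> k \<longrightarrow>
        (\<forall>x \<in> range ((*v) (P j)). \<forall>y \<in> range ((*v) (P k)). orthogonal x y)) \<and>
     mat 1 = (\<Sum>j\<in>UNIV. P j) \<and>
     (\<forall>j k. P j ** P k = (if k = j then P j else 0) \<and> P k ** P j = (if k = j then P j else 0)) \<and>
     Q = (\<Sum>j\<in>UNIV. tensor_prod (P j) (P j))"
proof -
  obtain v :: "'n \<Rightarrow> real ^ 'n" where v: "\<And>k l. v k \<bullet> v l = (if k = l then 1 else 0)"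
    and Q: "Q = (\<Sum>k\<in>UNIV. tensor_prod (outer_square (v k)) (outer_square (v k)))"
    using M_cross_orthonormal_decomposition[OF assms] by blast
  have nz: "v k \<noteq> 0" for k
    using v[of k k] by auto
  have mult: "outer_square (v j) ** outer_square (v k) = (if k = j then outer_square (v j) else 0)" for j k
    by (simp add: outer_square_mult v) (simp add: outer_square_def)
  show ?thesis
  \<comment> \<open>The images are the lines of the \<open>v k\<close>, so their perpendicularity is
    that of the basis.\<close>
  proof (intro exI[of _ "\<lambda>k. outer_square (v k)"] conjI allI impI ballI)
    fix j k x y
    assume "j \<noteq> k" "x \<in> range ((*v) (outer_square (v j)))" "y \<in> range ((*v) (outer_square (v k)))"
    then show "orthogonal x y"
      by (auto simp: outer_square_mult_vec orthogonal_def v)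
  next
    show "Q = (\<Sum>k\<in>UNIV. tensor_prod (outer_square (v k)) (outer_square (v k)))"
      by (rule Q)
  qed (simp_all add: orthogonal_projection_matrix_def transpose_outer_square nz mult v
      rank_outer_square trace_outer_square sum_outer_square_orthonormal[OF v])
qed

end
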